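(* For any geometric data sets $X,Y$, we have $d_{\mathrm{conc}}(X,Y)\le \Box(X,Y)$.
   Context: A geometric data set is a triple $X=(X,F_X,\mu_X)$ where $X$ is a non-empty set, $F_X$ is a non-empty set of functions $X\to\mathbb{R}$ such that $d_X(x,y):=\sup_{f\in F_X}|f(x)-f(y)|$ is finite for all $x,y\in X$ and is a complete separable metric on $X$, and $\mu_X$ is a Borel probability measure on $(X,d_X)$ with $\operatorname{supp}\mu_X=X$. For a family $F$ of functions and a map $\varphi$, $F\circ\varphi:=\{f\circ\varphi\mid f\in F\}$. Let $I=[0,1]$ with Lebesgue measure $\lambda$. A parameter of a Borel probability measure $\mu$ on $X$ is a Borel measurable map $\phi\colon I\to X$ with $\phi_*\lambda=\mu$. For a measure $\mu$, $d_{\mathrm{KF}}^{\mu}(f,g):=\inf\{\varepsilon\ge 0\mid \mu(\{x\mid |f(x)-g(x)|>\varepsilon\})\le\varepsilon\}$, and $(d_{\mathrm{KF}}^{\mu})_{\mathrm{H}}$ is the associated Hausdorff distance between sets of functions. The observable distance is $d_{\mathrm{conc}}(X,Y):=\inf_{\phi,\psi}(d_{\mathrm{KF}}^{\lambda})_{\mathrm{H}}(F_X\circ\phi,F_Y\circ\psi)$, where $\phi,\psi$ run over all parameters of $\mu_X$, $\mu_Y$ respectively. $\Pi(\mu_X,\mu_Y)$ is the set of couplings: Borel probability measures on $X\times Y$ with marginals $\mu_X,\mu_Y$; $\mathrm{pr}_1,\mathrm{pr}_2$ are the projections of $X\times Y$. For $S\subset X\times Y$, $d^S_\infty(f,g):=\sup_{s\in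 S}|f(s)-g(s)|$ (with $d^\emptyset_\infty\equiv0$), with Hausdorff distance $(d^S_\infty)_{\mathrm{H}}$ (values in $[0,+\infty]$). The box distance is $$\Box(X,Y):=\inf_{\pi,S}\max\{1-\pi(S),\ 2(d^S_\infty)_{\mathrm{H}}(F_X\circ\mathrm{pr}_1,F_Y\circ\mathrm{pr}_2)\},$$ where $\pi$ runs over $\Pi(\mu_X,\mu_Y)$ and $S$ over all closed subsets of $X\times Y$. *)

theory Defs
  imports "HOL-Probability.Probability"
begin

definition borel_of_top :: "'a topology \<Rightarrow> 'a measure" where
  "borel_of_top T = sigma (topspace T) {U. openin T U}"

definition topsupport :: "'a topology \<Rightarrow> 'a measure \<Rightarrow> 'a set" where
  "topsupport T \<mu> = {x \<in> topspace T. \<forall>U. openin T U \<and> x \<in> U \<longrightarrow> emeasure \<mu> U > 0}"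

text \<open>
  Functions on the carrier \<open>X\<close> are represented by total functions on the ambient type; their
  values outside \<open>X\<close> are arbitrary and never enter any of the notions below.
\<close>

record 'a gds =
  points :: "'a set"
  feats :: "('a \<Rightarrow> real) set"
  meas :: "'a measure"

text \<open>
  The value off the carrier is set to 0 only because the library's \<open>Metric_space\<close>
  asks for symmetry and nonnegativity on the whole type.
\<close>

definition gdist :: "'a gds \<Rightarrow> 'a \<Rightarrow> 'a \<Rightarrow> real" where
  "gdist X x y =
     (if x \<in> points X \<and> y \<in> points X then (SUP f\<in>feats X. \<bar>f x - f y\<bar>) else 0)"

definition gtop :: "'a gds \<Rightarrow> 'a topology" where
  "gtop X = Metric_space.mtopology (points X) (gdist X)"

text \<open>
  The \<open>bdd_above\<close> condition says that the supremum defining \<^term>\<open>gdist X x y\<close> is finite.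
  The equation on \<open>sets\<close> includes \<open>space (meas X) = points X\<close>.
\<close>

definition geometric_data_set :: "'a gds \<Rightarrow> bool" where
  "geometric_data_set X \<longleftrightarrow>
     points X \<noteq> {} \<and>
     feats X \<noteq> {} \<and>
     (\<forall>x\<in>points X. \<forall>y\<in>points X. bdd_above ((\<lambda>f. \<bar>f x - f y\<bar>) ` feats X)) \<and>
     Metric_space (points X) (gdist X) \<and>
     Metric_space.mcomplete (points X) (gdist X) \<and>
     separable_space (gtop X) \<and>
     sets (meas X) = sets (borel_of_top (gtop X)) \<and>
     prob_space (meas X) \<and>
     topsupport (gtop X) (meas X) = points X"

definition pullback :: "('a \<Rightarrow> real) set \<Rightarrow> ('b \<Rightarrow> 'a) \<Rightarrow> ('b \<Rightarrow> real) set" where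
  "pullback F \<phi> = (\<lambda>f. f \<circ> \<phi>) ` F"

text \<open>Distances take values in \<open>[0, \<infinity>]\<close>; in \<^typ>\<open>ennreal\<close> the supremum of the empty set is 0.\<close>

definition hausdorff_dist :: "('f \<Rightarrow> 'f \<Rightarrow> ennreal) \<Rightarrow> 'f set \<Rightarrow> 'f set \<Rightarrow> ennreal" where
  "hausdorff_dist d A B =
     max (SUP a\<in>A. INF b\<in>B. d a b) (SUP b\<in>B. INF a\<in>A. d a b)"

definition ky_fan :: "'a measure \<Rightarrow> ('a \<Rightarrow> real) \<Rightarrow> ('a \<Rightarrow> real) \<Rightarrow> ennreal" where
  "ky_fan \<mu> f g =
     Inf {ennreal \<epsilon> | \<epsilon>. 0 \<le> \<epsilon> \<and> emeasure \<mu> {x \<in> space \<mu>. \<bar>f x - g x\<bar> > \<epsilon>} \<le> ennreal \<epsilon>}"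

definition sup_dist :: "'a set \<Rightarrow> ('a \<Rightarrow> real) \<Rightarrow> ('a \<Rightarrow> real) \<Rightarrow> ennreal" where
  "sup_dist S f g = (SUP s\<in>S. ennreal \<bar>f s - g s\<bar>)"

definition unit_lebesgue :: "real measure" where
  "unit_lebesgue = restrict_space lborel {0..1}"

definition parameters :: "'a measure \<Rightarrow> (real \<Rightarrow> 'a) set" where
  "parameters \<mu> = {\<phi> \<in> measurable unit_lebesgue \<mu>. distr unit_lebesgue \<mu> \<phi> = \<mu>}"

text \<open>The infima below are taken in \<^typ>\<open>ennreal\<close>, where the infimum of the empty set is \<open>\<infinity>\<close>.\<close>

definition d_conc :: "'a gds \<Rightarrow> 'b gds \<Rightarrow> ennreal" where
  "d_conc X Y =
     (INF \<phi>\<in>parameters (meas X). INF \<psi>\<in>parameters (meas Y).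
        hausdorff_dist (ky_fan unit_lebesgue) (pullback (feats X) \<phi>) (pullback (feats Y) \<psi>))"

definition couplings :: "'a gds \<Rightarrow> 'b gds \<Rightarrow> ('a \<times> 'b) measure set" where
  "couplings X Y =
     {\<pi>. sets \<pi> = sets (borel_of_top (prod_topology (gtop X) (gtop Y))) \<and>
         prob_space \<pi> \<and>
         distr \<pi> (meas X) fst = meas X \<and>
         distr \<pi> (meas Y) snd = meas Y}"

definition box_dist :: "'a gds \<Rightarrow> 'b gds \<Rightarrow> ennreal" where
  "box_dist X Y =
     (INF \<pi>\<in>couplings X Y. INF S\<in>{S. closedin (prod_topology (gtop X) (gtop Y)) S}.
        max (1 - emeasure \<pi> S)
            (2 * hausdorff_dist (sup_dist S) (pullback (feats X) fst) (pullback (feats Y) snd)))"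

end

theory Submission
  imports Defs
begin

text \<open>
  A coupling \<open>\<pi>\<close> lives on a Polish space, hence has a parameter \<open>\<Phi>\<close>; its two components are
  parameters of the marginals. On \<open>\<Phi>\<inverse>(S)\<close>, an event of probability \<open>\<pi>(S)\<close>, the functions \<open>f \<circ> \<Phi>\<close>
  and \<open>g \<circ> \<Phi>\<close> differ by at most their supremum distance on \<open>S\<close>, so their Ky Fan distance is at
  most the larger of \<open>1 - \<pi>(S)\<close> and that supremum; the factor 2 in the box distance gives slack.

  To obtain \<open>\<Phi>\<close>, encode points of the Polish space as reals by a Borel map with a Borel left
  inverse, and decode the quantile function of the image measure.
\<close>

section \<open>Borel sets of a topology, and separability of products\<close>

lemma space_borel_of_top [simp]: "space (borel_of_top T) = topspace T"
  by (simp add: borel_of_top_def space_measure_of_conv)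

lemma openin_in_sets_borel_of_top: "openin T U \<Longrightarrow> U \<in> sets (borel_of_top T)"
  unfolding borel_of_top_def by (rule in_measure_of) (auto dest: openin_subset)

lemma closedin_in_sets_borel_of_top:
  assumes "closedin T C" shows "C \<in> sets (borel_of_top T)"
proof -
  have "topspace T - (topspace T - C) \<in> sets (borel_of_top T)"
    using assms openin_in_sets_borel_of_top[of T "topspace T - C"]
      sets.compl_sets[of _ "borel_of_top T"] by (auto simp: closedin_def)
  then show ?thesis
    using closedin_subset[OF assms] by (simp add: double_diff)
qed

lemma measurable_borel_of_topI:
  assumes "\<And>x. x \<in> space N \<Longrightarrow> f x \<in> topspace T"
    and "\<And>U. openin T U \<Longrightarrow> f -` U \<inter> space N \<in> sets N"
  shows "f \<in> N \<rightarrow>\<^sub>M borel_of_top T"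
  unfolding borel_of_top_def
  by (rule measurable_measure_of) (use assms in \<open>auto dest: openin_subset\<close>)

lemma continuous_map_measurable_borel_of_top:
  assumes "continuous_map S T f"
  shows "f \<in> borel_of_top S \<rightarrow>\<^sub>M borel_of_top T"
proof (rule measurable_borel_of_topI)
  fix U assume "openin T U"
  then have "openin S {x \<in> topspace S. f x \<in> U}"
    using assms by (simp add: continuous_map_def)
  moreover have "{x \<in> topspace S. f x \<in> U} = f -` U \<inter> space (borel_of_top S)"
    by auto
  ultimately show "f -` U \<inter> space (borel_of_top S) \<in> sets (borel_of_top S)"
    using openin_in_sets_borel_of_top by metis
qed (use assms in \<open>auto simp: continuous_map_def\<close>)

lemma separable_space_prod_topology:
  assumes "separable_space S" "separable_space T"
  shows "separable_space (prod_topology S T)"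
proof -
  obtain C D where "countable C" "C \<subseteq> topspace S" "S closure_of C = topspace S"
    "countable D" "D \<subseteq> topspace T" "T closure_of D = topspace T"
    using assms by (auto simp: separable_space_def)
  then show ?thesis
    unfolding separable_space_def
    by (intro exI[of _ "C \<times> D"]) (auto simp: closure_of_Times)
qed

section \<open>Coding bit sequences by real numbers\<close>

text \<open>Base 3 with digits 0 and 1 avoids the ambiguity of binary expansions: all later digits
  together contribute at most half of what a single digit 1 contributes, so the sequence can be read
  off its code.\<close>

definition ternary :: "(nat \<Rightarrow> bool) \<Rightarrow> real" where
  "ternary b = (\<Sum>n. of_bool (b n) * (1/3) ^ Suc n)"

text \<open>The iterated map deletes the leading digit of a code. It is defined on all reals, so
  that decoding is a Borel function on the whole line.\<close>

definition ternary_digit :: "nat \<Rightarrow> real \<Rightarrow> bool" where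
  "ternary_digit n r \<longleftrightarrow> 1/3 \<le> ((\<lambda>r. if 1/3 \<le> r then 3 * r - 1 else 3 * r) ^^ n) r"

lemma summable_ternary: "summable (\<lambda>n. of_bool (b n) * (1/3::real) ^ Suc n)"
  by (rule summable_comparison_test'[of "\<lambda>n. (1/3::real) ^ Suc n" 0])
    (auto simp: summable_geometric summable_mult)

lemma ternary_bounds: "0 \<le> ternary b" "ternary b \<le> 1/2"
proof -
  have s: "(\<lambda>n. (1/3::real) ^ Suc n) sums (1/2)"
    using sums_mult[OF geometric_sums[of "1/3::real"], of "1/3"] by simp
  show "0 \<le> ternary b"
    unfolding ternary_def by (intro suminf_nonneg summable_ternary) auto
  have "ternary b \<le> (\<Sum>n. (1/3::real) ^ Suc n)"
    unfolding ternary_def by (intro suminf_le summable_ternary sums_summable[OF s]) auto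
  then show "ternary b \<le> 1/2"
    using sums_unique[OF s] by simp
qed

lemma ternary_rec: "ternary b = (of_bool (b 0) + ternary (\<lambda>n. b (Suc n))) / 3"
proof -
  have "ternary b = (\<Sum>n. of_bool (b (Suc n)) * (1/3) ^ Suc (Suc n)) + of_bool (b 0) / 3"
    unfolding ternary_def using suminf_split_head[OF summable_ternary[of b]] by simp
  also have "(\<Sum>n. of_bool (b (Suc n)) * (1/3::real) ^ Suc (Suc n)) = ternary (\<lambda>n. b (Suc n)) / 3"
    unfolding ternary_def using suminf_divide[OF summable_ternary[of "\<lambda>n. b (Suc n)"], of 3]
    by simp
  finally show ?thesis by (simp add: add_divide_distrib)
qed

text \<open>A code is at least 1/3 if its first digit is 1 and at most 1/6 otherwise, so comparison
  with 1/3 reads that digit. Deleting it leaves the code of the shifted sequence, hence the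
  induction over all \<open>b\<close>.\<close>

lemma ternary_digit_ternary [simp]: "ternary_digit n (ternary b) = b n"
proof (induction n arbitrary: b)
  case 0
  show ?case
    using ternary_rec[of b] ternary_bounds[of "\<lambda>n. b (Suc n)"]
    by (cases "b 0") (auto simp: ternary_digit_def)
next
  case (Suc n)
  have "(if 1/3 \<le> ternary b then 3 * ternary b - 1 else 3 * ternary b) = ternary (\<lambda>n. b (Suc n))"
    using ternary_rec[of b] ternary_bounds[of "\<lambda>n. b (Suc n)"] by (cases "b 0") auto
  then have "ternary_digit (Suc n) (ternary b) = ternary_digit n (ternary (\<lambda>n. b (Suc n)))"
    by (simp add: ternary_digit_def funpow_Suc_right del: funpow.simps)
  with Suc show ?case by simp
qed

lemma measurable_ternary_digit [measurable]: "ternary_digit n \<in> borel \<rightarrow>\<^sub>M count_space UNIV"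
proof -
  have [measurable]: "((\<lambda>r::real. if 1/3 \<le> r then 3 * r - 1 else 3 * r) ^^ n) \<in> borel_measurable borel"
  proof (induction n)
    case (Suc n)
    then have "(\<lambda>r::real. if 1/3 \<le> r then 3 * r - 1 else 3 * r) \<circ>
       ((\<lambda>r::real. if 1/3 \<le> r then 3 * r - 1 else 3 * r) ^^ n) \<in> borel_measurable borel"
      by (rule measurable_comp) measurable
    then show ?case by (simp only: funpow.simps)
  qed (simp add: id_def)
  show ?thesis
    unfolding ternary_digit_def by measurable
qed

lemma measurable_ternary [measurable (raw)]:
  assumes "\<And>n. (\<lambda>x. b x n) \<in> N \<rightarrow>\<^sub>M count_space UNIV"
  shows "(\<lambda>x. ternary (b x)) \<in> borel_measurable N"
proof -
  have [measurable]: "Measurable.pred N (\<lambda>x. b x n)" for n using assms .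
  show ?thesis
    unfolding ternary_def by measurable
qed

section \<open>Borel encoding of a Polish space in the reals\<close>

context Metric_space
begin

text \<open>
  An open set is the increasing union of the closed sets \<open>C m\<close> of points at distance at least
  \<open>1/(m+1)\<close> from its complement, and a limit lies in it iff the sequence is eventually in one of them.
\<close>

lemma measurable_limitin:
  assumes y: "\<And>k. y k \<in> N \<rightarrow>\<^sub>M borel_of_top mtopology"
    and lim: "\<And>t. t \<in> space N \<Longrightarrow> limitin mtopology (\<lambda>k. y k t) (g t) sequentially"
  shows "g \<in> N \<rightarrow>\<^sub>M borel_of_top mtopology"
proof (rule measurable_borel_of_topI)
  show "g t \<in> topspace mtopology" if "t \<in> space N" for t
    using limitin_mspace[OF lim[OF that]] by simp
  fix U assume U: "openin mtopology U"
  define C where "C m = M - (\<Union>w\<in>M - U. mball w (inverse (Suc m)))" for m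
  have C: "C m \<in> sets (borel_of_top mtopology)" for m
    unfolding C_def by (intro closedin_in_sets_borel_of_top closedin_diff openin_Union) auto
  have iff: "g t \<in> U \<longleftrightarrow> (\<exists>m K. \<forall>k\<ge>K. y k t \<in> C m)" if t: "t \<in> space N" for t
  proof
    have L: "g t \<in> M" "\<And>e. e > 0 \<Longrightarrow> \<exists>K. \<forall>k\<ge>K. y k t \<in> M \<and> d (y k t) (g t) < e"
      using lim[OF t] by (auto simp: limit_metric_sequentially)
    {
      assume "g t \<in> U"
      then obtain r where r: "r > 0" "mball (g t) r \<subseteq> U"
        using U by (auto simp: openin_mtopology)
      \<comment> \<open>One half of \<open>r\<close> pays for the distance from \<open>g t\<close>
        to \<open>y k t\<close>, the other for the distance from \<open>y k t\<close> to a point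
        \<open>w\<close> outside \<open>U\<close>.\<close>
      obtain m where m: "inverse (real (Suc m)) < r / 2"
        using reals_Archimedean[of "r/2"] r by auto
      obtain K where K: "\<And>k. k \<ge> K \<Longrightarrow> y k t \<in> M \<and> d (y k t) (g t) < r / 2"
        using L(2)[of "r/2"] r by auto
      have "y k t \<in> C m" if "k \<ge> K" for k
      proof -
        have False if w: "w \<in> M" "w \<notin> U" "d w (y k t) < inverse (real (Suc m))" for w
        proof -
          have "d (g t) w \<le> d (g t) (y k t) + d (y k t) w"
            using triangle L(1) K[OF \<open>k \<ge> K\<close>] w by blast
          also have "\<dots> < r"
            using K[OF \<open>k \<ge> K\<close>] w m by (auto simp: commute)
          finally show False using r w L(1) by auto
        qed
        then show ?thesis using K[OF that] by (auto simp: C_def)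
      qed
      then show "\<exists>m K. \<forall>k\<ge>K. y k t \<in> C m" by blast
    }
    {
      assume "\<exists>m K. \<forall>k\<ge>K. y k t \<in> C m"
      then obtain m K where K: "\<And>k. k \<ge> K \<Longrightarrow> y k t \<in> C m" by blast
      obtain K' where K': "\<And>k. k \<ge> K' \<Longrightarrow> y k t \<in> M \<and> d (y k t) (g t) < inverse (Suc m)"
        using L(2)[of "inverse (Suc m)"] by auto
      \<comment> \<open>Otherwise \<open>g t\<close> is itself one of the points \<open>w\<close> in
        the definition of \<open>C m\<close>, and \<open>y k t\<close> comes too close to
        it.\<close>
      show "g t \<in> U"
        using K[of "max K K'"] K'[of "max K K'"] L(1) by (auto simp: C_def commute)
    }
  qed
  have [measurable]: "Measurable.pred N (\<lambda>t. y k t \<in> C m)" for k m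
    by (rule pred_sets2[OF C y])
  have "{t \<in> space N. \<exists>m K. \<forall>k\<ge>K. y k t \<in> C m} \<in> sets N"
    by measurable
  also have "{t \<in> space N. \<exists>m K. \<forall>k\<ge>K. y k t \<in> C m} = g -` U \<inter> space N"
    using iff by auto
  finally show "g -` U \<inter> space N \<in> sets N" .
qed

text \<open>
  A point is encoded by the answers to the questions whether it lies in the ball of radius
  \<open>1/(k+1)\<close> around the \<open>i\<close>-th point of a dense sequence; completeness lets the decoder be
  defined as a limit.
\<close>

lemma borel_real_encoding:
  assumes "mcomplete" "separable_space mtopology" "M \<noteq> {}"
  obtains h :: "'a \<Rightarrow> real" and G where "h \<in> borel_of_top mtopology \<rightarrow>\<^sub>M borel"
    "G \<in> borel \<rightarrow>\<^sub>M borel_of_top mtopology" "\<And>z. z \<in> M \<Longrightarrow> G (h z) = z"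
proof -
  obtain D where D: "countable D" "D \<subseteq> M" "mtopology closure_of D = M"
    using assms(2) by (auto simp: separable_space_def)
  with assms(3) have "D \<noteq> {}" by auto
  then obtain x :: "nat \<Rightarrow> 'a" where x: "range x = D"
    using D(1) by (metis uncountable_def)
  then have xM: "x i \<in> M" for i using D by auto
  have dense: "\<exists>i. d (x i) z < r" if z: "z \<in> M" and r: "r > 0" for z r
  proof -
    have "z \<in> mtopology closure_of D" using D z by simp
    then obtain w where "w \<in> D" "w \<in> mball z r"
      using r unfolding metric_closure_of by blast
    then show ?thesis using x by (auto simp: commute)
  qed
  \<comment> \<open>\<open>prod_decode\<close> lists the questions, indexed by pairs
    \<open>(k, i)\<close>, in a single sequence.\<close>
  define b where "b z = (\<lambda>(k, i). d (x i) z < inverse (real (Suc k))) \<circ> prod_decode" for z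
  define h where "h z = ternary (b z)" for z
  \<comment> \<open>The first point of the dense sequence whose ball of radius
    \<open>1/(k+1)\<close> contains the encoded point, according to the digits of
    \<open>r\<close>.\<close>
  define idx where "idx k r = (LEAST i. ternary_digit (prod_encode (k, i)) r)" for k r
  \<comment> \<open>Not every real is a code. Outside \<open>R\<close> the sequence \<open>y\<close>
    is constant, so it converges for every real and \<open>G\<close> is a pointwise limit on the
    whole line.\<close>
  define R where "R = {r. MCauchy (\<lambda>k. x (idx k r))}"
  define y where "y k r = (if r \<in> R then x (idx k r) else x 0)" for k r
  define G where "G r = (SOME l. limitin mtopology (\<lambda>k. y k r) l sequentially)" for r
  have h: "h \<in> borel_of_top mtopology \<rightarrow>\<^sub>M borel"
    unfolding h_def
  proof (rule measurable_ternary)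
    fix n
    obtain k i where n: "prod_decode n = (k, i)" by force
    have "{z \<in> space (borel_of_top mtopology). b z n} = mball (x i) (inverse (Suc k))"
      using xM by (auto simp: b_def n)
    then show "(\<lambda>z. b z n) \<in> borel_of_top mtopology \<rightarrow>\<^sub>M count_space UNIV"
      unfolding pred_def by (simp add: openin_in_sets_borel_of_top)
  qed
  have idx [measurable]: "idx k \<in> borel \<rightarrow>\<^sub>M count_space UNIV" for k
    unfolding idx_def by measurable
  \<comment> \<open>Restricting the tolerances to \<open>1/(m+1)\<close> leaves only quantifiers
    over natural numbers, which makes \<open>R\<close> a Borel set.\<close>
  have R_eq: "R = {r. \<forall>m. \<exists>K. \<forall>n\<ge>K. \<forall>n'\<ge>K. d (x (idx n r)) (x (idx n' r)) < inverse (real (Suc m))}"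
  proof (intro set_eqI iffI)
    fix r assume "r \<in> R"
    then show "r \<in> {r. \<forall>m. \<exists>K. \<forall>n\<ge>K. \<forall>n'\<ge>K. d (x (idx n r)) (x (idx n' r)) < inverse (real (Suc m))}"
      unfolding R_def MCauchy_def by simp
  next
    fix r assume r: "r \<in> {r. \<forall>m. \<exists>K. \<forall>n\<ge>K. \<forall>n'\<ge>K. d (x (idx n r)) (x (idx n' r)) < inverse (real (Suc m))}"
    show "r \<in> R"
      unfolding R_def MCauchy_def
    proof (intro CollectI conjI allI impI)
      fix e :: real assume "e > 0"
      then obtain m where m: "inverse (real (Suc m)) < e" using reals_Archimedean by blast
      from r obtain K where "\<forall>n\<ge>K. \<forall>n'\<ge>K. d (x (idx n r)) (x (idx n' r)) < inverse (real (Suc m))"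
        by blast
      with m show "\<exists>K. \<forall>n n'. K \<le> n \<longrightarrow> K \<le> n' \<longrightarrow> d (x (idx n r)) (x (idx n' r)) < e"
        by (meson less_trans)
    qed (use xM in auto)
  qed
  \<comment> \<open>Both indices take values in the natural numbers, so the condition splits into
    countably many cases.\<close>
  have [measurable]: "Measurable.pred borel (\<lambda>r. d (x (idx n r)) (x (idx n' r)) < e)" for n n' e
    by (rule measurable_compose_countable[OF _ idx[of n], where f = "\<lambda>i r. d (x i) (x (idx n' r)) < e"])
      (rule measurable_compose[OF idx], simp)
  have [measurable]: "R \<in> sets borel"
    unfolding R_eq by measurable
  have y: "y k \<in> borel \<rightarrow>\<^sub>M borel_of_top mtopology" for k
  proof -
    \<comment> \<open>With the case distinction moved into the index, \<open>y k\<close> factors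
      through a discrete space, on which every map into \<open>M\<close> is measurable.\<close>
    have "(\<lambda>r. x (if r \<in> R then idx k r else 0)) \<in> borel \<rightarrow>\<^sub>M borel_of_top mtopology"
      by (rule measurable_compose[where N="count_space UNIV"]) (use xM in auto)
    moreover have "y k = (\<lambda>r. x (if r \<in> R then idx k r else 0))" by (auto simp: y_def)
    ultimately show ?thesis by simp
  qed
  have ylim: "limitin mtopology (\<lambda>k. y k r) (G r) sequentially" for r
  proof -
    have "MCauchy (\<lambda>k. y k r)"
      using xM by (cases "r \<in> R") (auto simp: y_def R_def)
    then show ?thesis
      unfolding G_def using assms(1) someI_ex unfolding mcomplete_def by fast
  qed
  have "G (h z) = z" if z: "z \<in> M" for z
  proof -
    \<comment> \<open>For a genuine code, density makes the search in \<open>idx\<close> succeed,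
      and the digit found is a true answer about \<open>z\<close>.\<close>
    have near: "d (x (idx k (h z))) z < inverse (real (Suc k))" for k
    proof -
      have "\<exists>i. ternary_digit (prod_encode (k, i)) (h z)"
        using dense[OF z, of "inverse (real (Suc k))"] by (simp add: h_def b_def)
      then have "ternary_digit (prod_encode (k, idx k (h z))) (h z)"
        unfolding idx_def by (rule LeastI_ex)
      then show ?thesis by (simp add: h_def b_def)
    qed
    have lim: "limitin mtopology (\<lambda>k. x (idx k (h z))) z sequentially"
      unfolding limit_metric_sequentially
    proof (intro conjI z allI impI)
      fix e :: real assume "e > 0"
      then obtain m where m: "inverse (real (Suc m)) < e" using reals_Archimedean by blast
      have "d (x (idx n (h z))) z < e" if "n \<ge> m" for n
      proof -
        have "inverse (real (Suc n)) \<le> inverse (real (Suc m))"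
          using that by (simp add: le_imp_inverse_le)
        with near[of n] m show ?thesis by linarith
      qed
      then show "\<exists>N. \<forall>n\<ge>N. x (idx n (h z)) \<in> M \<and> d (x (idx n (h z))) z < e"
        using xM by blast
    qed
    then have "h z \<in> R"
      unfolding R_def using xM by (auto intro: convergent_imp_MCauchy)
    with lim have "limitin mtopology (\<lambda>k. y k (h z)) z sequentially"
      by (simp add: y_def)
    with ylim show ?thesis
      by (rule limitin_metric_unique) simp
  qed
  with h measurable_limitin[OF y ylim] show ?thesis using that by blast
qed

end

section \<open>Existence of parameters\<close>

text \<open>The quantile function \<open>I\<close>, the generalized inverse of the distribution
  function, carries Lebesgue measure on the open unit interval to \<open>\<nu>\<close>. The function
  \<open>q\<close> extends it by 0.\<close>

lemma real_distribution_eq_distr_unit_lebesgue: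
  assumes "real_distribution \<nu>"
  obtains q where "q \<in> borel_measurable unit_lebesgue" "distr unit_lebesgue borel q = \<nu>"
proof -
  interpret cdf_distribution \<nu> using assms by (simp add: cdf_distribution_def)
  let ?J = "{0<..<1::real}"
  define q where "q t = (if t \<in> ?J then I t else 0)" for t
  have [measurable]: "q \<in> borel_measurable borel"
    unfolding q_def using measurable_CI
    by (intro measurable_restrict_space_iff[THEN iffD1, rotated 2]) auto
  have q: "q \<in> borel_measurable unit_lebesgue"
    unfolding unit_lebesgue_def by (rule measurable_restrict_space1) simp
  have "distr unit_lebesgue borel q = distr (restrict_space lborel ?J) borel I"
  proof (rule measure_eqI)
    fix A assume "A \<in> sets (distr unit_lebesgue borel q)"
    then have A [measurable]: "A \<in> sets borel" by simp
    have [measurable]: "I \<in> borel_measurable (restrict_space lborel ?J)"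
      using measurable_CI by (simp cong: measurable_cong_sets add: sets_restrict_space)
    have [measurable]: "q -` A \<in> sets borel"
      by (rule measurable_sets_borel) measurable
    have "emeasure (distr unit_lebesgue borel q) A = emeasure lborel (q -` A \<inter> {0..1})"
      using q by (simp add: emeasure_distr unit_lebesgue_def emeasure_restrict_space space_restrict_space)
    \<comment> \<open>The two sets can differ only at 0 and 1, which form a null set.\<close>
    also have "\<dots> = emeasure lborel (q -` A \<inter> ?J)"
    proof (rule emeasure_eq_AE)
      show "AE t in lborel. t \<in> q -` A \<inter> {0..1} \<longleftrightarrow> t \<in> q -` A \<inter> ?J"
        using AE_lborel_singleton[of "0::real"] AE_lborel_singleton[of "1::real"]
        by eventually_elim auto
    qed simp_all
    also have "q -` A \<inter> ?J = I -` A \<inter> ?J" by (auto simp: q_def)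
    also have "emeasure lborel \<dots> = emeasure (distr (restrict_space lborel ?J) borel I) A"
      by (simp add: emeasure_distr emeasure_restrict_space space_restrict_space)
    finally show "emeasure (distr unit_lebesgue borel q) A =
      emeasure (distr (restrict_space lborel ?J) borel I) A" .
  qed simp
  with distr_I_eq_M q that show ?thesis by metis
qed

text \<open>If \<open>q\<close> carries Lebesgue measure to the image of \<open>\<mu>\<close> under
  \<open>h\<close>, then \<open>G \<circ> q\<close> carries it to the image of \<open>\<mu>\<close>
  under \<open>G \<circ> h\<close>, which is the identity on the space.\<close>

lemma parameters_nonempty:
  assumes T: "completely_metrizable_space T" "separable_space T"
    and \<mu>: "sets \<mu> = sets (borel_of_top T)" "prob_space \<mu>"
  shows "parameters \<mu> \<noteq> {}"
proof -
  obtain M d where "Metric_space M d" and M: "Metric_space.mcomplete M d" "T = Metric_space.mtopology M d"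
    using T(1) by (auto simp: completely_metrizable_space_def)
  interpret Metric_space M d by fact
  interpret prob_space \<mu> by fact
  have sp: "space \<mu> = M" using sets_eq_imp_space_eq[OF \<mu>(1)] M(2) by simp
  then have "M \<noteq> {}" using not_empty by simp
  then obtain h :: "'a \<Rightarrow> real" and G where hG: "h \<in> borel_of_top T \<rightarrow>\<^sub>M borel"
    "G \<in> borel \<rightarrow>\<^sub>M borel_of_top T" and inv: "\<And>z. z \<in> M \<Longrightarrow> G (h z) = z"
    using borel_real_encoding M T(2) by metis
  have h: "h \<in> \<mu> \<rightarrow>\<^sub>M borel" and G: "G \<in> borel \<rightarrow>\<^sub>M \<mu>"
    using hG \<mu>(1) by (simp_all cong: measurable_cong_sets)
  have "real_distribution (distr \<mu> borel h)"
    using h by (simp add: real_distribution_def real_distribution_axioms_def prob_space_distr)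
  then obtain q where q: "q \<in> borel_measurable unit_lebesgue" "distr unit_lebesgue borel q = distr \<mu> borel h"
    by (rule real_distribution_eq_distr_unit_lebesgue)
  have "distr unit_lebesgue \<mu> (G \<circ> q) = distr (distr \<mu> borel h) \<mu> G"
    using distr_distr[OF G q(1)] q(2) by simp
  also have "\<dots> = distr \<mu> \<mu> (G \<circ> h)"
    by (rule distr_distr[OF G h])
  also have "\<dots> = distr \<mu> \<mu> (\<lambda>z. z)"
    by (rule distr_cong) (auto simp: sp inv)
  finally have "distr unit_lebesgue \<mu> (G \<circ> q) = \<mu>" by simp
  moreover have "G \<circ> q \<in> unit_lebesgue \<rightarrow>\<^sub>M \<mu>"
    using q(1) G by (rule measurable_comp)
  ultimately show ?thesis by (auto simp: parameters_def)
qed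

text \<open>Image measures compose; with \<open>p\<close> a projection, a parameter of a coupling
  yields parameters of both marginals on the same interval.\<close>

lemma parameters_comp:
  assumes "\<Phi> \<in> parameters \<pi>" "p \<in> \<pi> \<rightarrow>\<^sub>M \<mu>" "distr \<pi> \<mu> p = \<mu>"
  shows "p \<circ> \<Phi> \<in> parameters \<mu>"
  using assms distr_distr[of p \<pi> \<mu> \<Phi> unit_lebesgue]
  by (auto simp: parameters_def intro: measurable_comp)

section \<open>Hausdorff and Ky Fan estimates\<close>

text \<open>The maximum with the constant \<open>e\<close> commutes with infima, so a pointwise
  bound passes to one half of the Hausdorff distance even when no infimum is attained.\<close>

lemma SUP_INF_image_le_max:
  fixes d :: "'f \<Rightarrow> 'g \<Rightarrow> ennreal"
  assumes le: "\<And>f g. f \<in> A \<Longrightarrow> g \<in> B \<Longrightarrow> d' (u f) (v g) \<le> max e (d f g)"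
  shows "(SUP a\<in>u ` A. INF b\<in>v ` B. d' a b) \<le> max e (SUP a\<in>A. INF b\<in>B. d a b)"
  unfolding image_image
proof (rule SUP_least)
  fix a assume a: "a \<in> A"
  have "(INF b\<in>B. d' (u a) (v b)) \<le> (INF b\<in>B. max e (d a b))"
    using le[OF a] by (intro INF_mono) auto
  also have "\<dots> = max e (INF b\<in>B. d a b)"
    unfolding sup_max[symmetric] by (simp add: sup_INF)
  also have "\<dots> \<le> max e (SUP a\<in>A. INF b\<in>B. d a b)"
    using a by (intro max.mono SUP_upper order_refl)
  finally show "(INF b\<in>B. d' (u a) (v b)) \<le> max e (SUP a\<in>A. INF b\<in>B. d a b)" .
qed

lemma hausdorff_dist_image_le_max:
  assumes "\<And>f g. f \<in> A \<Longrightarrow> g \<in> B \<Longrightarrow> d' (u f) (u g) \<le> max e (d f g)"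
  shows "hausdorff_dist d' (u ` A) (u ` B) \<le> max e (hausdorff_dist d A B)"
proof -
  have "(SUP a\<in>u ` A. INF b\<in>u ` B. d' a b) \<le> max e (SUP a\<in>A. INF b\<in>B. d a b)"
    using assms by (rule SUP_INF_image_le_max)
  \<comment> \<open>The other half is the same estimate with the arguments of both distances
    exchanged.\<close>
  moreover have "(SUP b\<in>u ` B. INF a\<in>u ` A. d' a b) \<le> max e (SUP b\<in>B. INF a\<in>A. d a b)"
    by (rule SUP_INF_image_le_max[where d' = "\<lambda>b a. d' a b" and d = "\<lambda>b a. d a b"]) (rule assms)
  ultimately show ?thesis
    unfolding hausdorff_dist_def by (auto simp: le_max_iff_disj)
qed

text \<open>The right-hand side, if finite, is an admissible tolerance \<open>e\<close>: a
  difference above \<open>e\<close> forces \<open>\<Phi> t\<close> out of \<open>S\<close>, an event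
  of probability \<open>1 - \<pi>(S)\<close>, which is at most \<open>e\<close>.\<close>

lemma ky_fan_parameter_le:
  assumes \<Phi>: "\<Phi> \<in> parameters \<pi>" and \<pi>: "prob_space \<pi>" and S: "S \<in> sets \<pi>"
  shows "ky_fan unit_lebesgue (F \<circ> \<Phi>) (G \<circ> \<Phi>) \<le> max (1 - emeasure \<pi> S) (sup_dist S F G)"
\<comment> \<open>Tolerances in \<open>ky_fan\<close> are real numbers, so an infinite supremum is
  treated apart.\<close>
proof (cases "sup_dist S F G")
  case (real r)
  interpret prob_space \<pi> by fact
  define e where "e = max (1 - measure \<pi> S) r"
  have e: "ennreal e = max (1 - emeasure \<pi> S) (sup_dist S F G)" "e \<ge> 0"
    using real by (simp_all add: e_def max_def emeasure_eq_measure ennreal_minus_if le_max_iff_disj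
        flip: ennreal_1)
  have "{t \<in> space unit_lebesgue. \<bar>(F \<circ> \<Phi>) t - (G \<circ> \<Phi>) t\<bar> > e}
      \<subseteq> \<Phi> -` (space \<pi> - S) \<inter> space unit_lebesgue"
  proof
    fix t assume "t \<in> {t \<in> space unit_lebesgue. \<bar>(F \<circ> \<Phi>) t - (G \<circ> \<Phi>) t\<bar> > e}"
    then have t: "t \<in> space unit_lebesgue" "\<bar>F (\<Phi> t) - G (\<Phi> t)\<bar> > e" by auto
    have "\<Phi> t \<in> space \<pi>"
      using \<Phi> t by (auto simp: parameters_def dest: measurable_space)
    moreover have "\<Phi> t \<notin> S"
    proof
      assume "\<Phi> t \<in> S"
      then have "ennreal \<bar>F (\<Phi> t) - G (\<Phi> t)\<bar> \<le> ennreal r"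
        unfolding real(2)[symmetric] sup_dist_def by (rule SUP_upper)
      with t real(1) show False by (simp add: e_def)
    qed
    ultimately show "t \<in> \<Phi> -` (space \<pi> - S) \<inter> space unit_lebesgue" using t by simp
  qed
  then have "emeasure unit_lebesgue {t \<in> space unit_lebesgue. \<bar>(F \<circ> \<Phi>) t - (G \<circ> \<Phi>) t\<bar> > e}
      \<le> emeasure unit_lebesgue (\<Phi> -` (space \<pi> - S) \<inter> space unit_lebesgue)"
    using \<Phi> S by (intro emeasure_mono) (auto simp: parameters_def intro: measurable_sets)
  also have "\<dots> = emeasure (distr unit_lebesgue \<pi> \<Phi>) (space \<pi> - S)"
    using \<Phi> S by (subst emeasure_distr) (auto simp: parameters_def)
  also have "\<dots> = emeasure \<pi> (space \<pi> - S)"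
    using \<Phi> by (simp add: parameters_def)
  also have "\<dots> = 1 - emeasure \<pi> S"
    using S by (simp add: emeasure_compl emeasure_space_1)
  also have "\<dots> \<le> ennreal e" using e by simp
  finally have "ky_fan unit_lebesgue (F \<circ> \<Phi>) (G \<circ> \<Phi>) \<le> ennreal e"
    unfolding ky_fan_def using e(2) by (intro Inf_lower) auto
  then show ?thesis using e by simp
next
  case top
  then show ?thesis by simp
qed

section \<open>Comparison of the two distances\<close>

lemma completely_metrizable_gtop:
  "geometric_data_set X \<Longrightarrow> completely_metrizable_space (gtop X)"
  by (auto simp: geometric_data_set_def gtop_def completely_metrizable_space_def)

lemma separable_gtop: "geometric_data_set X \<Longrightarrow> separable_space (gtop X)"
  by (simp add: geometric_data_set_def)

theorem proposition5p2:
  fixes X :: "'a gds" and Y :: "'b gds"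
  assumes "geometric_data_set X" and "geometric_data_set Y"
  shows "d_conc X Y \<le> box_dist X Y"
  unfolding box_dist_def
proof (intro INF_greatest)
  fix \<pi> S assume \<pi>: "\<pi> \<in> couplings X Y"
    and closed: "S \<in> {S. closedin (prod_topology (gtop X) (gtop Y)) S}"
  let ?T = "prod_topology (gtop X) (gtop Y)"
  have sets: "sets \<pi> = sets (borel_of_top ?T)" and prob: "prob_space \<pi>"
    and marg: "distr \<pi> (meas X) fst = meas X" "distr \<pi> (meas Y) snd = meas Y"
    using \<pi> by (auto simp: couplings_def)
  have S: "S \<in> sets \<pi>"
    using closed by (simp add: sets closedin_in_sets_borel_of_top)
  have "parameters \<pi> \<noteq> {}"
    using assms[THEN completely_metrizable_gtop] assms[THEN separable_gtop] sets prob
    by (intro parameters_nonempty[of ?T] separable_space_prod_topology)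
      (simp_all add: completely_metrizable_space_prod_topology)
  then obtain \<Phi> where \<Phi>: "\<Phi> \<in> parameters \<pi>" by blast
  have setsX: "sets (meas X) = sets (borel_of_top (gtop X))"
    and setsY: "sets (meas Y) = sets (borel_of_top (gtop Y))"
    using assms by (auto simp: geometric_data_set_def)
  have "fst \<in> \<pi> \<rightarrow>\<^sub>M meas X" "snd \<in> \<pi> \<rightarrow>\<^sub>M meas Y"
    using continuous_map_measurable_borel_of_top[OF continuous_map_fst, of "gtop X" "gtop Y"]
      continuous_map_measurable_borel_of_top[OF continuous_map_snd, of "gtop X" "gtop Y"]
    by (simp_all add: measurable_cong_sets[OF sets setsX] measurable_cong_sets[OF sets setsY])
  then have par: "fst \<circ> \<Phi> \<in> parameters (meas X)" "snd \<circ> \<Phi> \<in> parameters (meas Y)"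
    using parameters_comp[OF \<Phi>] marg by auto
  let ?H = "hausdorff_dist (sup_dist S) (pullback (feats X) fst) (pullback (feats Y) snd)"
  have "d_conc X Y \<le> hausdorff_dist (ky_fan unit_lebesgue)
      (pullback (feats X) (fst \<circ> \<Phi>)) (pullback (feats Y) (snd \<circ> \<Phi>))"
    unfolding d_conc_def using par by (meson INF_lower INF_lower2)
  \<comment> \<open>Both families now arise from functions on the product by the same map,
    composition with \<open>\<Phi>\<close>, as the Hausdorff estimate requires.\<close>
  also have "\<dots> = hausdorff_dist (ky_fan unit_lebesgue)
      ((\<lambda>f. f \<circ> \<Phi>) ` pullback (feats X) fst) ((\<lambda>g. g \<circ> \<Phi>) ` pullback (feats Y) snd)"
    by (simp add: pullback_def image_image comp_assoc)
  also have "\<dots> \<le> max (1 - emeasure \<pi> S) ?H"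
    by (intro hausdorff_dist_image_le_max ky_fan_parameter_le \<Phi> prob S)
  also have "\<dots> \<le> max (1 - emeasure \<pi> S) (2 * ?H)"
    by (rule max.mono) (simp_all add: mult_2)
  finally show "d_conc X Y \<le> max (1 - emeasure \<pi> S) (2 * ?H)" .
qed

end
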